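(* Let $d\ge2$ and let $g:\mathbb{R}^{d-1}\to\mathbb{R}$ be a $C^2$ function. Write points of $\mathbb{R}^d$ as $(x',t)\in\mathbb{R}^{d-1}\times\mathbb{R}$ and, for $\alpha\in\mathbb{R}^{d-1}$, set $$\varphi_\alpha^g(x',t)=\langle\alpha,x'\rangle+\big(t-g(x')\big)^2.$$ Let $\boldsymbol{\alpha}=(\alpha_1,\ldots,\alpha_d)\in(\mathbb{R}^{d-1})^d$ be an affinely independent tuple, and let $\mathsf{H}_{\boldsymbol{\alpha}}^g=(\varphi_{\alpha_1}^g,\ldots,\varphi_{\alpha_d}^g)$ with critical set $\Sigma_{\boldsymbol{\alpha}}^g=\{x\in\mathbb{R}^d:\operatorname{rank}D_x\mathsf{H}_{\boldsymbol{\alpha}}^g(x)\le d-1\}$. Then $$\Sigma_{\boldsymbol{\alpha}}^g=\big\{(x',t)\in\mathbb{R}^d:t=g(x')\big\}.$$ Every point of $\Sigma_{\boldsymbol{\alpha}}^g$ is fold non-degenerate. Consequently, the family $\{\varphi_{\alpha_1}^g,\ldots,\varphi_{\alpha_d}^g\}$ is admissible.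
   Context: For a family of $d$ scalar $C^2$ functions on $\mathbb{R}^d$ with encoding map $\mathsf{H}=(\varphi_1,\ldots,\varphi_d)$, critical set $\Sigma=\{x:\operatorname{rank}D_x\mathsf{H}(x)\le d-1\}$ and $J=\det D_x\mathsf{H}$: a point $x\in\Sigma$ is fold non-degenerate if $\operatorname{rank}D_x\mathsf{H}(x)=d-1$ and $D_xJ(x)[v]\neq0$ for every $v\in\ker D_x\mathsf{H}(x)\setminus\{0\}$. The family is admissible if there is a $C^1$ embedded $(d-1)$-dimensional submanifold $M\subset\mathbb{R}^d$ (possibly empty) with $\Sigma\subseteq M$ and $\operatorname{rank}(D_x\mathsf{H}(x)|_{T_xM})=d-1$ for every $x\in M$. *)

theory Defs
  imports "HOL-Analysis.Analysis"
begin

text \<open>The derivative is taken at the points of \<open>S\<close> in the ambient space, so this is meant for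
  open \<open>S\<close>.\<close>

definition C1_on :: "'a::real_normed_vector set \<Rightarrow> ('a \<Rightarrow> 'b::real_normed_vector) \<Rightarrow> bool" where
  "C1_on S f \<longleftrightarrow> (\<exists>f'. (\<forall>x\<in>S. (f has_derivative blinfun_apply (f' x)) (at x)) \<and> continuous_on S f')"

definition C2 :: "('a::real_normed_vector \<Rightarrow> 'b::real_normed_vector) \<Rightarrow> bool" where
  "C2 f \<longleftrightarrow> (\<exists>f'. (\<forall>x. (f has_derivative blinfun_apply (f' x)) (at x)) \<and> C1_on UNIV f')"

text \<open>Local straightening by a \<open>C\<^sup>1\<close> diffeomorphism onto an open piece of a
  \<open>k\<close>-dimensional linear subspace (which plays the role of \<open>\<real>\<^sup>k \<times> {0}\<close>).\<close>

definition C1_submanifold :: "nat \<Rightarrow> 'a::euclidean_space set \<Rightarrow> bool" where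
  "C1_submanifold k M \<longleftrightarrow>
    (\<forall>p\<in>M. \<exists>U V (\<Phi> :: 'a \<Rightarrow> 'a) \<Psi> L.
       open U \<and> p \<in> U \<and> open V \<and> homeomorphism U V \<Phi> \<Psi> \<and> C1_on U \<Phi> \<and> C1_on V \<Psi> \<and>
       subspace L \<and> dim L = k \<and> \<Phi> ` (U \<inter> M) = V \<inter> L)"

text \<open>Velocities at \<open>x\<close> of \<open>C\<^sup>1\<close> curves in \<open>M\<close>.\<close>

definition tangent_space :: "'a::euclidean_space set \<Rightarrow> 'a \<Rightarrow> 'a set" where
  "tangent_space M x = {v. \<exists>\<gamma> \<epsilon>. \<epsilon> > 0 \<and> C1_on {-\<epsilon><..<\<epsilon>} \<gamma> \<and> (\<forall>s\<in>{-\<epsilon><..<\<epsilon>}. \<gamma> s \<in> M) \<and>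
     \<gamma> (0::real) = x \<and> (\<gamma> has_vector_derivative v) (at 0)}"

definition encoding_map :: "('d::finite \<Rightarrow> real^'d \<Rightarrow> real) \<Rightarrow> real^'d \<Rightarrow> real^'d" where
  "encoding_map \<phi> x = (\<chi> i. \<phi> i x)"

definition critical_set :: "('d::finite \<Rightarrow> real^'d \<Rightarrow> real) \<Rightarrow> (real^'d) set" where
  "critical_set \<phi> = {x. rank (jacobian (encoding_map \<phi>) (at x)) \<le> CARD('d) - 1}"

definition jacobian_det :: "('d::finite \<Rightarrow> real^'d \<Rightarrow> real) \<Rightarrow> real^'d \<Rightarrow> real" where
  "jacobian_det \<phi> x = det (jacobian (encoding_map \<phi>) (at x))"

definition fold_nondegenerate :: "('d::finite \<Rightarrow> real^'d \<Rightarrow> real) \<Rightarrow> real^'d \<Rightarrow> bool" where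
  "fold_nondegenerate \<phi> x \<longleftrightarrow>
     x \<in> critical_set \<phi> \<and>
     rank (jacobian (encoding_map \<phi>) (at x)) = CARD('d) - 1 \<and>
     (\<forall>v. frechet_derivative (encoding_map \<phi>) (at x) v = 0 \<and> v \<noteq> 0 \<longrightarrow>
          frechet_derivative (jacobian_det \<phi>) (at x) v \<noteq> 0)"

text \<open>Admissibility is a notion for \<open>C\<^sup>2\<close> families, so \<open>C\<^sup>2\<close> regularity is part of it. The rank of
  the restriction of the derivative to the tangent space is the dimension of the image.\<close>

definition admissible :: "('d::finite \<Rightarrow> real^'d \<Rightarrow> real) \<Rightarrow> bool" where
  "admissible \<phi> \<longleftrightarrow>
     (\<forall>i. C2 (\<phi> i)) \<and>
     (\<exists>M. C1_submanifold (CARD('d) - 1) M \<and> critical_set \<phi> \<subseteq> M \<and>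
       (\<forall>x\<in>M. dim (frechet_derivative (encoding_map \<phi>) (at x) ` tangent_space M x) = CARD('d) - 1))"

text \<open>A finite tuple is affinely independent iff it has no repetitions and its set of entries is
  not affinely dependent; \<open>affine_dependent\<close> alone does not see repetitions.\<close>

definition affinely_independent_tuple :: "('i \<Rightarrow> 'a::real_vector) \<Rightarrow> bool" where
  "affinely_independent_tuple \<alpha> \<longleftrightarrow> inj \<alpha> \<and> \<not> affine_dependent (range \<alpha>)"

text \<open>With \<open>d - 1 = CARD('m)\<close>, points of \<open>\<real>\<^sup>d\<close> are vectors indexed by \<open>'m option\<close>: the coordinates
  \<open>Some j\<close> form \<open>x'\<close> and the coordinate \<open>None\<close> is \<open>t\<close>. As \<open>'m\<close> is nonempty, \<open>d \<ge> 2\<close>.\<close>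

definition point :: "real^'m \<Rightarrow> real \<Rightarrow> real^('m::finite option)" where
  "point x' t = (\<chi> i. case i of None \<Rightarrow> t | Some j \<Rightarrow> x' $ j)"

definition base :: "real^('m::finite option) \<Rightarrow> real^'m" where
  "base x = (\<chi> j. x $ Some j)"

definition height :: "real^('m::finite option) \<Rightarrow> real" where
  "height x = x $ None"

lemma base_point [simp]: "base (point x' t) = x'"
  by (simp add: base_def point_def vec_eq_iff)

lemma height_point [simp]: "height (point x' t) = t"
  by (simp add: height_def point_def)

lemma point_base_height [simp]: "point (base x) (height x) = x"
  by (auto simp: base_def height_def point_def vec_eq_iff split: option.splits)

definition fold_fun :: "(real^'m \<Rightarrow> real) \<Rightarrow> real^'m \<Rightarrow> real^('m::finite option) \<Rightarrow> real" where
  "fold_fun g a x = a \<bullet> base x + (height x - g (base x))\<^sup>2"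

lemma fold_fun_point: "fold_fun g a (point x' t) = a \<bullet> x' + (t - g x')\<^sup>2"
  by (simp add: fold_fun_def)

definition fold_family ::
    "(real^'m \<Rightarrow> real) \<Rightarrow> ('m option \<Rightarrow> real^'m) \<Rightarrow> 'm option \<Rightarrow> real^('m::finite option) \<Rightarrow> real" where
  "fold_family g \<alpha> i = fold_fun g (\<alpha> i)"

end

theory Submission imports Defs begin

text \<open>Put \<open>u(x', t) = t - g x'\<close>. The derivative of the encoding map at \<open>x\<close> factors as \<open>L \<circ> T\<^sub>x\<close>, where
  \<open>L (a, s)\<close> has entries \<open>\<langle>\<alpha>\<^sub>i, a\<rangle> + s\<close> and \<open>T\<^sub>x h = (h', 2 u(x) Du(x)[h])\<close>. Affine independence of
  \<open>\<alpha>\<close> means that \<open>L\<close> is invertible, and \<open>det T\<^sub>x = 2 u(x)\<close>. Hence the Jacobian determinant is a nonzero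
  multiple of \<open>u\<close>: the critical set is the graph \<open>u = 0\<close>, on which the kernel of the derivative is
  vertical while \<open>Du\<close> is not zero on vertical vectors. The graph itself is the required submanifold,
  straightened by \<open>(x', t) \<mapsto> (x', u(x', t))\<close>.\<close>

section \<open>Calculus of \<open>C\<^sup>1\<close> and \<open>C\<^sup>2\<close> functions\<close>

lemma C1_on_subset: "C1_on T f \<Longrightarrow> S \<subseteq> T \<Longrightarrow> C1_on S f"
  unfolding C1_on_def by (meson continuous_on_subset subsetD)

lemma C1_on_imp_continuous_on: "C1_on S f \<Longrightarrow> continuous_on S f"
  unfolding C1_on_def
  by (meson continuous_at_imp_continuous_on has_derivative_continuous)

lemma C1_on_bounded_linear: "bounded_linear f \<Longrightarrow> C1_on S f"
  unfolding C1_on_def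
  by (rule exI[of _ "\<lambda>_. Blinfun f"])
    (auto simp: bounded_linear_Blinfun_apply bounded_linear_imp_has_derivative)

lemma C1_on_const: "C1_on S (\<lambda>_. c)"
  unfolding C1_on_def by (rule exI[of _ "\<lambda>_. 0"]) (auto simp: zero_blinfun.rep_eq)

lemma C1_on_add:
  assumes "C1_on S f" "C1_on S g"
  shows "C1_on S (\<lambda>x. f x + g x)"
proof -
  obtain f' g' where "\<And>x. x \<in> S \<Longrightarrow> (f has_derivative blinfun_apply (f' x)) (at x)" "continuous_on S f'"
    "\<And>x. x \<in> S \<Longrightarrow> (g has_derivative blinfun_apply (g' x)) (at x)" "continuous_on S g'"
    using assms unfolding C1_on_def by metis
  then show ?thesis
    unfolding C1_on_def
    by (intro exI[of _ "\<lambda>x. f' x + g' x"])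
      (auto intro!: continuous_intros derivative_eq_intros simp: plus_blinfun.rep_eq)
qed

lemma C1_on_compose:
  assumes "C1_on T f" "C1_on S g" "g ` S \<subseteq> T"
  shows "C1_on S (\<lambda>x. f (g x))"
proof -
  obtain f' g' where f: "\<And>x. x \<in> T \<Longrightarrow> (f has_derivative blinfun_apply (f' x)) (at x)" "continuous_on T f'"
    and g: "\<And>x. x \<in> S \<Longrightarrow> (g has_derivative blinfun_apply (g' x)) (at x)" "continuous_on S g'"
    using assms unfolding C1_on_def by metis
  have "((\<lambda>x. f (g x)) has_derivative blinfun_apply (f' (g x) o\<^sub>L g' x)) (at x)" if "x \<in> S" for x
    using has_derivative_compose[OF g(1)[OF that] f(1)] assms(3) that
    by (auto simp: blinfun_compose.rep_eq o_def)
  moreover have "continuous_on S (\<lambda>x. f' (g x) o\<^sub>L g' x)"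
    using continuous_on_compose2[OF f(2) C1_on_imp_continuous_on[OF assms(2)] assms(3)] g(2)
    by (intro continuous_intros) auto
  ultimately show ?thesis
    unfolding C1_on_def by (intro exI[of _ "\<lambda>x. f' (g x) o\<^sub>L g' x"]) auto
qed

lemma C1_on_linear_compose: "bounded_linear L \<Longrightarrow> C1_on S f \<Longrightarrow> C1_on S (\<lambda>x. L (f x))"
  using C1_on_compose[OF C1_on_bounded_linear[of L UNIV]] by blast

lemma C1_on_scaleR:
  fixes f :: "'a::real_normed_vector \<Rightarrow> real" and g :: "'a \<Rightarrow> 'b::real_normed_vector"
  assumes "C1_on S f" "C1_on S g"
  shows "C1_on S (\<lambda>x. f x *\<^sub>R g x)"
proof -
  obtain f' g' where f: "\<And>x. x \<in> S \<Longrightarrow> (f has_derivative blinfun_apply (f' x)) (at x)" "continuous_on S f'"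
    and g: "\<And>x. x \<in> S \<Longrightarrow> (g has_derivative blinfun_apply (g' x)) (at x)" "continuous_on S g'"
    using assms unfolding C1_on_def by metis
  \<comment> \<open>The second summand is \<open>h \<mapsto> f' x h *\<^sub>R g x\<close>, written
    with \<open>blinfun_scaleR_left\<close> so that its continuity in \<open>x\<close> is that of an
    operator-valued map.\<close>
  let ?D = "\<lambda>x. f x *\<^sub>R g' x + (blinfun_scaleR_left (g x) o\<^sub>L f' x)"
  have "((\<lambda>x. f x *\<^sub>R g x) has_derivative blinfun_apply (?D x)) (at x)" if "x \<in> S" for x
    using f(1)[OF that] g(1)[OF that]
    by (auto intro!: derivative_eq_intros simp: plus_blinfun.rep_eq scaleR_blinfun.rep_eq)
  moreover have "continuous_on S ?D"
    using C1_on_imp_continuous_on[OF assms(1)] C1_on_imp_continuous_on[OF assms(2)] f(2) g(2)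
    by (intro continuous_intros bounded_linear.continuous_on[OF bounded_linear_blinfun_scaleR_left])
  ultimately show ?thesis
    unfolding C1_on_def by (intro exI[of _ ?D]) auto
qed

lemma C2_imp_C1_on: "C2 f \<Longrightarrow> C1_on S f"
  unfolding C2_def C1_on_def
  by (metis UNIV_I continuous_at_imp_continuous_on has_derivative_continuous)

lemma C2_bounded_linear: "bounded_linear f \<Longrightarrow> C2 f"
  unfolding C2_def
  by (rule exI[of _ "\<lambda>_. Blinfun f"])
    (auto simp: bounded_linear_Blinfun_apply bounded_linear_imp_has_derivative C1_on_const)

lemma C2_add:
  assumes "C2 f" "C2 g"
  shows "C2 (\<lambda>x. f x + g x)"
proof -
  obtain f' g' where "\<And>x. (f has_derivative blinfun_apply (f' x)) (at x)" "C1_on UNIV f'"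
    "\<And>x. (g has_derivative blinfun_apply (g' x)) (at x)" "C1_on UNIV g'"
    using assms unfolding C2_def by metis
  then show ?thesis
    unfolding C2_def
    by (intro exI[of _ "\<lambda>x. f' x + g' x"])
      (auto intro!: C1_on_add derivative_eq_intros simp: plus_blinfun.rep_eq)
qed

lemma C2_linear_compose:
  assumes "bounded_linear L" "C2 f"
  shows "C2 (\<lambda>x. L (f x))"
proof -
  obtain f' where f: "\<And>x. (f has_derivative blinfun_apply (f' x)) (at x)" "C1_on UNIV f'"
    using assms(2) unfolding C2_def by metis
  have "((\<lambda>x. L (f x)) has_derivative blinfun_apply (Blinfun L o\<^sub>L f' x)) (at x)" for x
    using bounded_linear.has_derivative[OF assms(1) f(1)[of x]]
    by (simp add: blinfun_compose.rep_eq o_def bounded_linear_Blinfun_apply assms(1))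
  \<comment> \<open>Composing with a fixed operator is itself bounded linear on the space of
    operators, so it preserves the \<open>C1_on\<close> property of \<open>f'\<close>.\<close>
  moreover have "C1_on UNIV (\<lambda>x. Blinfun L o\<^sub>L f' x)"
    by (rule C1_on_linear_compose[OF bounded_bilinear.bounded_linear_right
          [OF bounded_bilinear_blinfun_compose] f(2)])
  ultimately show ?thesis
    unfolding C2_def by (intro exI[of _ "\<lambda>x. Blinfun L o\<^sub>L f' x"]) auto
qed

lemma C2_compose_linear:
  assumes "C2 f" "bounded_linear L"
  shows "C2 (\<lambda>x. f (L x))"
proof -
  obtain f' where f: "\<And>x. (f has_derivative blinfun_apply (f' x)) (at x)" "C1_on UNIV f'"
    using assms(1) unfolding C2_def by metis
  have "((\<lambda>x. f (L x)) has_derivative blinfun_apply (f' (L x) o\<^sub>L Blinfun L)) (at x)" for x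
    using has_derivative_compose[OF bounded_linear_imp_has_derivative[OF assms(2)] f(1)]
    by (simp add: blinfun_compose.rep_eq o_def bounded_linear_Blinfun_apply assms(2))
  moreover have "C1_on UNIV (\<lambda>x. f' (L x) o\<^sub>L Blinfun L)"
    by (rule C1_on_linear_compose[OF bounded_bilinear.bounded_linear_left
          [OF bounded_bilinear_blinfun_compose]
          C1_on_compose[OF f(2) C1_on_bounded_linear[OF assms(2)] subset_UNIV]])
  ultimately show ?thesis
    unfolding C2_def by (intro exI[of _ "\<lambda>x. f' (L x) o\<^sub>L Blinfun L"]) auto
qed

text \<open>The derivative \<open>2 f f'\<close> is a scalar multiple of \<open>f'\<close>, so the
  product rule at the \<open>C1_on\<close> level suffices.\<close>

lemma C2_power2:
  fixes f :: "'a::real_normed_vector \<Rightarrow> real"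
  assumes "C2 f"
  shows "C2 (\<lambda>x. (f x)\<^sup>2)"
proof -
  obtain f' where f: "\<And>x. (f has_derivative blinfun_apply (f' x)) (at x)" "C1_on UNIV f'"
    using assms unfolding C2_def by metis
  have "((\<lambda>x. (f x)\<^sup>2) has_derivative blinfun_apply ((2 *\<^sub>R f x) *\<^sub>R f' x)) (at x)" for x
    using f(1)[of x]
    by (auto intro!: derivative_eq_intros simp: scaleR_blinfun.rep_eq)
  moreover have "C1_on UNIV (\<lambda>x. (2 *\<^sub>R f x) *\<^sub>R f' x)"
    by (intro C1_on_scaleR f C1_on_linear_compose[of "\<lambda>r. 2 *\<^sub>R r"] C2_imp_C1_on assms
        bounded_linear_scaleR_right)
  ultimately show ?thesis
    unfolding C2_def by (intro exI[of _ "\<lambda>x. (2 *\<^sub>R f x) *\<^sub>R f' x"]) auto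
qed

section \<open>The fold family\<close>

lemma bounded_linear_base: "bounded_linear base"
  by (auto intro!: linear_conv_bounded_linear[THEN iffD1] linearI simp: base_def vec_eq_iff)

lemma bounded_linear_height: "bounded_linear height"
  unfolding height_def by (rule bounded_linear_vec_nth)

lemma eq_iff_base_height: "x = y \<longleftrightarrow> base x = base y \<and> height x = height y"
  by (metis point_base_height)

lemma base_height_simps [simp]: "base (x + y) = base x + base y" "base (c *\<^sub>R x) = c *\<^sub>R base x"
  "base (x - y) = base x - base y" "base 0 = 0" "height (x + y) = height x + height y"
  "height (c *\<^sub>R x) = c * height x"
  "height (x - y) = height x - height y" "height 0 = 0"
  by (auto simp: base_def height_def vec_eq_iff)

lemma base_height_axis_None [simp]: "base (axis None c) = 0" "height (axis None c) = c"
  by (auto simp: base_def height_def vec_eq_iff axis_def)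

section \<open>Linear algebra of the two factors of the derivative\<close>

definition gap :: "(real^'m \<Rightarrow> real) \<Rightarrow> real^('m::finite option) \<Rightarrow> real" where
  "gap g x = height x - g (base x)"

text \<open>The map \<open>L\<close> of the overview; the pair \<open>(a, s)\<close> is encoded as
  one vector \<open>y\<close> so that \<open>L\<close> is an endomorphism and has a
  determinant.\<close>

definition affine_eval :: "('m option \<Rightarrow> real^'m) \<Rightarrow> real^('m::finite option) \<Rightarrow> real^('m option)" where
  "affine_eval \<alpha> y = (\<chi> i. \<alpha> i \<bullet> base y + height y)"

lemma linear_affine_eval: "linear (affine_eval \<alpha>)"
  by (auto intro!: linearI simp: affine_eval_def vec_eq_iff algebra_simps)

text \<open>A kernel vector \<open>y\<close> gives an affine equation satisfied by every entry of
  \<alpha>. These d affinely independent points affinely span the space of dimension d - 1, so the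
  equation holds everywhere and must be trivial.\<close>

lemma inj_affine_eval:
  fixes \<alpha> :: "'m::finite option \<Rightarrow> real^'m"
  assumes "affinely_independent_tuple \<alpha>"
  shows "inj (affine_eval \<alpha>)"
proof -
  have "card (range \<alpha>) = Suc (DIM(real^'m))"
    using assms by (simp add: affinely_independent_tuple_def card_image)
  then have hull: "affine hull (range \<alpha>) = UNIV"
    using assms affine_independent_span_eq[of "range \<alpha>"]
    by (simp add: affinely_independent_tuple_def)
  have "y = 0" if "affine_eval \<alpha> y = 0" for y
  proof -
    have "range \<alpha> \<subseteq> {z. base y \<bullet> z = - height y}"
      using that by (auto simp: affine_eval_def vec_eq_iff inner_commute eq_neg_iff_add_eq_0)
    then have *: "base y \<bullet> z = - height y" for z
      using hull_minimal[of "range \<alpha>" _ affine] affine_hyperplane[of "base y" "- height y"] hull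
      by blast
    \<comment> \<open>The point 0 forces \<open>height y = 0\<close>; then the point
      \<open>base y\<close> forces \<open>base y \<bullet> base y = 0\<close>.\<close>
    show ?thesis
      using *[of 0] *[of "base y"] by (simp add: eq_iff_base_height)
  qed
  then show ?thesis
    using linear_affine_eval linear_injective_0 by blast
qed

lemma dim_height_0: "dim {y :: real^('m::finite option). height y = 0} = CARD('m)"
  using dim_hyperplane[of "axis None 1 :: real^('m option)"]
  by (simp add: height_def inner_axis inner_commute axis_eq_0_iff)

text \<open>The row \<open>None\<close> differs from that of a diagonal matrix by a combination of the other rows.\<close>

lemma det_height_map:
  fixes l :: "real^'m::finite \<Rightarrow> real"
  assumes "linear l"
  shows "det (matrix (\<lambda>h. point (base h) (l (base h) + c * height h))) = c"
    (is "det (matrix ?T) = c")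
proof -
  define A :: "real^('m option)^('m option)"
    where "A = (\<chi> i j. if i = j then (if i = None then c else 1) else 0)"
  have row_Some: "row (Some j) A = axis (Some j) 1" for j
    by (auto simp: A_def row_def axis_def vec_eq_iff)
  \<comment> \<open>The rows \<open>Some j\<close> of \<open>A\<close> are unit vectors, so
    \<open>x\<close> lists the coefficients of \<open>l\<close>, with 0 at \<open>None\<close>.
    Adding it to row \<open>None\<close> of \<open>A\<close> yields the last row
    \<open>(l, c)\<close> of \<open>matrix ?T\<close>.\<close>
  define x :: "real^('m option)"
    where "x = (\<Sum>j\<in>UNIV. l (axis j 1) *s row (Some j) A)"
  have x_nth: "x $ k = (case k of None \<Rightarrow> 0 | Some j \<Rightarrow> l (axis j 1))" for k
    by (cases k) (simp_all add: x_def row_Some axis_def if_distrib cong: if_cong)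
  have "x \<in> vec.span {row j A | j. j \<noteq> None}"
    unfolding x_def by (intro vec.span_sum vec.span_scale vec.span_base) auto
  then have "det (\<chi> k. if k = None then row None A + x else row k A) = det A"
    by (rule det_row_span)
  also have "(\<chi> k. if k = None then row None A + x else row k A) = matrix ?T"
  proof -
    have axis_Some: "base (axis (Some j) 1) = axis j 1" "height (axis (Some j) 1) = 0" for j :: 'm
      by (auto simp: base_def height_def axis_def vec_eq_iff)
    have axis_nth: "(axis j 1 :: real^'m) $ i = (if i = j then 1 else 0)" for i j :: 'm
      by (simp add: axis_def)
    show ?thesis
    proof (intro vec_eq_iff[THEN iffD2] allI)
      fix i k
      show "(\<chi> k. if k = None then row None A + x else row k A) $ i $ k = matrix ?T $ i $ k"
        by (cases i; cases k)
          (simp_all add: matrix_def row_def A_def x_nth point_def axis_Some axis_nth linear_0[OF assms])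
    qed
  qed
  also have "det A = c"
    by (subst det_diagonal) (auto simp: A_def UNIV_option_conv prod.reindex)
  finally show ?thesis .
qed

section \<open>The derivative of the encoding map and its determinant\<close>

definition encoding_derivative ::
    "(real^'m \<Rightarrow> real) \<Rightarrow> (real^'m \<Rightarrow> real) \<Rightarrow> ('m option \<Rightarrow> real^'m) \<Rightarrow>
      real^('m::finite option) \<Rightarrow> real^('m option) \<Rightarrow> real^('m option)" where
  "encoding_derivative g g' \<alpha> x h =
     affine_eval \<alpha> (point (base h) (2 * gap g x * (height h - g' (base h))))"

lemma has_derivative_gap:
  assumes "(g has_derivative g') (at (base x))"
  shows "(gap g has_derivative (\<lambda>h. height h - g' (base h))) (at x)"
  unfolding gap_def[abs_def]
  by (intro has_derivative_diff bounded_linear_imp_has_derivative bounded_linear_height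
      has_derivative_compose[OF bounded_linear_imp_has_derivative[OF bounded_linear_base] assms])

text \<open>With u = \<open>gap g\<close>, component i has derivative
  \<open>\<alpha> i \<bullet> h' + 2 u(x) Du(x)[h]\<close>, which is entry i of \<open>L\<close>
  applied to \<open>T\<^sub>x h\<close>.\<close>

lemma has_derivative_encoding_map:
  assumes "(g has_derivative g') (at (base x))"
  shows "(encoding_map (fold_family g \<alpha>) has_derivative encoding_derivative g g' \<alpha> x) (at x)"
proof -
  have "((\<lambda>x. \<alpha> i \<bullet> base x + (gap g x)\<^sup>2) has_derivative
      (\<lambda>h. \<alpha> i \<bullet> base h + 2 * gap g x * (height h - g' (base h)))) (at x)" for i
    by (auto intro!: derivative_eq_intros has_derivative_gap[OF assms]
        bounded_linear_imp_has_derivative bounded_linear_base)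
  then show ?thesis
    by (subst has_derivative_componentwise_within)
      (auto simp: Basis_vec_def inner_axis encoding_map_def fold_family_def fold_fun_def gap_def
        encoding_derivative_def affine_eval_def)
qed

lemma det_encoding_derivative:
  assumes "linear g'"
  shows "det (matrix (encoding_derivative g g' \<alpha> x)) = det (matrix (affine_eval \<alpha>)) * (2 * gap g x)"
proof -
  \<comment> \<open>Expanding \<open>2 u(x) (height h - g' (base h))\<close> separates a linear form
    in \<open>base h\<close> from a multiple of \<open>height h\<close>, the shape treated by
    \<open>det_height_map\<close>.\<close>
  let ?l = "\<lambda>a. - (2 * gap g x) * g' a"
  let ?T = "\<lambda>h. point (base h) (?l (base h) + 2 * gap g x * height h)"
  have l: "linear ?l"
    using linear_compose_scale_right[OF assms, of "- (2 * gap g x)"] by simp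
  have "linear ?T"
    by (auto intro!: linearI simp: eq_iff_base_height linear_add[OF assms] linear_cmul[OF assms] algebra_simps)
  moreover have "encoding_derivative g g' \<alpha> x = affine_eval \<alpha> \<circ> ?T"
    by (auto simp: encoding_derivative_def fun_eq_iff algebra_simps)
  ultimately show ?thesis
    using det_height_map[OF l, of "2 * gap g x"] linear_affine_eval[of \<alpha>]
    by (simp add: matrix_compose det_mul)
qed

text \<open>Reduces the rank computations on the graph to the dimension of the hyperplane
  \<open>height y = 0\<close>.\<close>

lemma dim_image_affine_eval:
  assumes "affinely_independent_tuple \<alpha>"
  shows "dim (affine_eval \<alpha> ` S) = dim S"
  using dim_image_eq[OF linear_affine_eval] inj_affine_eval[OF assms]
  by (metis inj_on_subset subset_UNIV)

section \<open>The critical set, its fold points and the graph as a submanifold\<close>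

theorem proposition5p10:
  fixes g :: "real^'m::finite \<Rightarrow> real"
    and \<alpha> :: "'m option \<Rightarrow> real^'m"
  assumes "C2 g"
    and "affinely_independent_tuple \<alpha>"
  shows "critical_set (fold_family g \<alpha>) = {point x' t | x' t. t = g x'}
    \<and> (\<forall>x\<in>critical_set (fold_family g \<alpha>). fold_nondegenerate (fold_family g \<alpha>) x)
    \<and> admissible (fold_family g \<alpha>)"
proof -
  let ?\<phi> = "fold_family g \<alpha>"
  obtain g' where g': "\<And>a. (g has_derivative blinfun_apply (g' a)) (at a)"
    using assms(1) unfolding C2_def by metis
  define Dg where "Dg a = blinfun_apply (g' a)" for a
  have Dg: "(g has_derivative Dg a) (at a)" for a
    unfolding Dg_def by (rule g')
  have lin: "linear (Dg a)" for a
    using Dg by (rule has_derivative_linear)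
  define DH where "DH x = encoding_derivative g (Dg (base x)) \<alpha> x" for x
  have DH: "frechet_derivative (encoding_map ?\<phi>) (at x) = DH x" for x
    unfolding DH_def
    using frechet_derivative_at[OF has_derivative_encoding_map[OF Dg]] by metis
  have linDH: "linear (DH x)" for x
    unfolding DH_def using has_derivative_linear[OF has_derivative_encoding_map[OF Dg]] .
  define c where "c = 2 * det (matrix (affine_eval \<alpha>))"
  have c: "c \<noteq> 0"
    using inj_affine_eval[OF assms(2)] det_nz_iff_inj[OF linear_affine_eval[of \<alpha>]]
    by (simp add: c_def)
  have J: "jacobian_det ?\<phi> = (\<lambda>x. c * gap g x)"
    by (auto simp: jacobian_det_def jacobian_def DH fun_eq_iff DH_def det_encoding_derivative[OF lin] c_def)
  have rank_range: "rank (jacobian (encoding_map ?\<phi>) (at x)) = dim (range (DH x))" for x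
    by (simp add: jacobian_def DH rank_dim_range matrix_vector_mul(2)[OF linDH])
  \<comment> \<open>Off the graph the determinant is nonzero, so the rank is d =
    \<open>CARD('m) + 1\<close>.\<close>
  have full: "\<not> rank (jacobian (encoding_map ?\<phi>) (at x)) \<le> CARD('m)" if "gap g x \<noteq> 0" for x
    using that c J det_eq_0_rank[of "jacobian (encoding_map ?\<phi>) (at x)"]
    by (auto simp: jacobian_det_def fun_eq_iff)
  \<comment> \<open>On the graph the factor \<open>2 u(x)\<close> removes the derivative of
    \<open>g\<close>, so \<open>DH x h\<close> depends only on \<open>base h\<close>.\<close>
  have DH0: "DH x h = affine_eval \<alpha> (point (base h) 0)" if "gap g x = 0" for x h
    using that by (simp add: DH_def encoding_derivative_def)
  have "range (\<lambda>h. point (base h) 0) = {y :: real^('m option). height y = 0}"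
    by (auto simp: image_iff) (metis point_base_height)
  then have range0: "range (DH x) = affine_eval \<alpha> ` {y. height y = 0}" if "gap g x = 0" for x
    using DH0[OF that] by (metis (mono_tags, lifting) image_cong image_image)
  have rank0: "rank (jacobian (encoding_map ?\<phi>) (at x)) = CARD('m)" if "gap g x = 0" for x
    by (simp add: rank_range range0[OF that] dim_image_affine_eval[OF assms(2)] dim_height_0)
  have crit: "critical_set ?\<phi> = {x. gap g x = 0}"
    using full rank0 by (auto simp: critical_set_def)
  have graph: "{x. gap g x = 0} = {point x' t | x' t. t = g x'}"
    by (auto simp: gap_def) (metis point_base_height)
  have fold: "fold_nondegenerate ?\<phi> x" if x: "gap g x = 0" for x
  proof -
    have "frechet_derivative (jacobian_det ?\<phi>) (at x) v \<noteq> 0" if v: "DH x v = 0" "v \<noteq> 0" for v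
    proof -
      \<comment> \<open>Injectivity of \<open>L\<close> makes a kernel vector vertical; on it the
        derivative of the determinant is \<open>c * height v\<close>.\<close>
      have "point (base v) 0 = 0"
        using v(1) DH0[OF x] inj_affine_eval[OF assms(2)] linear_affine_eval
        by (metis linear_injective_0)
      then have "base v = 0"
        by (simp add: eq_iff_base_height)
      moreover from this have "height v \<noteq> 0"
        using v(2) by (simp add: eq_iff_base_height)
      moreover have "(jacobian_det ?\<phi> has_derivative (\<lambda>h. c * (height h - Dg (base x) (base h)))) (at x)"
        unfolding J by (intro has_derivative_mult_right has_derivative_gap Dg)
      ultimately show ?thesis
        using c linear_0[OF lin] by (simp add: frechet_derivative_at[symmetric])
    qed
    then show ?thesis
      using x rank0 by (simp add: fold_nondegenerate_def crit DH)
  qed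
  have gbase: "C2 (\<lambda>x :: real^('m option). g (base x))"
    by (rule C2_compose_linear[OF assms(1) bounded_linear_base])
  have C2_family: "C2 (?\<phi> i)" for i
  proof -
    have "C2 (\<lambda>x :: real^('m option). (height x + - g (base x))\<^sup>2)"
      by (intro C2_power2 C2_add C2_bounded_linear bounded_linear_height
          C2_linear_compose[OF bounded_linear_minus[OF bounded_linear_ident]] gbase)
    moreover have "C2 (\<lambda>x :: real^('m option). \<alpha> i \<bullet> base x)"
      by (intro C2_bounded_linear bounded_linear_inner_right_comp bounded_linear_base)
    ultimately show ?thesis
      unfolding fold_family_def fold_fun_def[abs_def] by (auto dest: C2_add)
  qed
  \<comment> \<open>These shears along the t-axis fix \<open>base\<close>, so the values r = -1 and
    r = 1 give mutually inverse maps: \<Phi> flattens the graph and \<Psi> restores it.\<close>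
  have graph_shift: "C1_on UNIV (\<lambda>y :: real^('m option). y + r *\<^sub>R g (base y) *\<^sub>R axis None 1)" for r
    by (intro C1_on_add C1_on_bounded_linear bounded_linear_ident C1_on_linear_compose[of "\<lambda>s. r *\<^sub>R s *\<^sub>R _"]
        C2_imp_C1_on gbase bounded_linear_const_scaleR bounded_linear_scaleR_left)
  define \<Phi> \<Psi> :: "real^('m option) \<Rightarrow> real^('m option)"
    where "\<Phi> y = y + (-1) *\<^sub>R g (base y) *\<^sub>R axis None 1"
      and "\<Psi> y = y + 1 *\<^sub>R g (base y) *\<^sub>R axis None 1" for y
  have C1: "C1_on UNIV \<Phi>" "C1_on UNIV \<Psi>"
    unfolding \<Phi>_def[abs_def] \<Psi>_def[abs_def] by (rule graph_shift)+
  have inverse: "\<Psi> (\<Phi> y) = y" "\<Phi> (\<Psi> y) = y" for y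
    by (simp_all add: \<Phi>_def \<Psi>_def eq_iff_base_height)
  have base_\<Psi>: "base (\<Psi> y) = base y" for y
    by (simp add: \<Psi>_def)
  have gap_\<Psi>: "gap g (\<Psi> y) = height y" for y
    by (simp add: \<Psi>_def gap_def)
  have submanifold: "C1_submanifold (CARD('m)) {x. gap g x = 0}"
    unfolding C1_submanifold_def
  \<comment> \<open>A single global chart, with \<open>U = V = UNIV\<close>, serves every
    point.\<close>
  proof (intro ballI exI conjI)
    show "homeomorphism UNIV UNIV \<Phi> \<Psi>"
      unfolding homeomorphism_def
      using C1_on_imp_continuous_on[OF C1(1)] C1_on_imp_continuous_on[OF C1(2)]
      by (auto simp: inverse) (metis inverse rangeI)+
    show "subspace {y :: real^('m option). height y = 0}"
      by (auto simp: subspace_def)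
    show "\<Phi> ` (UNIV \<inter> {x. gap g x = 0}) = UNIV \<inter> {y. height y = 0}"
      by (auto simp: image_iff) (metis gap_\<Psi> inverse)+
  qed (auto simp: C1 dim_height_0)
  have tangent: "dim (DH x ` tangent_space {x. gap g x = 0} x) = CARD('m)" if x: "gap g x = 0" for x
  proof -
    have "DH x ` tangent_space {x. gap g x = 0} x = affine_eval \<alpha> ` {y. height y = 0}"
    proof (intro equalityI)
      show "DH x ` tangent_space {x. gap g x = 0} x \<subseteq> affine_eval \<alpha> ` {y. height y = 0}"
        \<comment> \<open>Already the image of the whole space under \<open>DH x\<close> is this
          set.\<close>
        using range0[OF x] by blast
    next
      show "affine_eval \<alpha> ` {y. height y = 0} \<subseteq> DH x ` tangent_space {x. gap g x = 0} x"
      proof clarify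
        fix y :: "real^('m option)"
        assume y: "height y = 0"
        \<comment> \<open>A straight line in the flattened coordinates, carried back to the graph:
          \<open>gap g (\<gamma> s)\<close> equals \<open>height (\<Phi> x + s *\<^sub>R y)\<close>,
          which is 0.\<close>
        define \<gamma> where "\<gamma> s = \<Psi> (\<Phi> x + s *\<^sub>R y)" for s
        have C1_\<gamma>: "C1_on UNIV \<gamma>"
          unfolding \<gamma>_def[abs_def]
          by (intro C1_on_compose[OF C1(2)] C1_on_add C1_on_const C1_on_bounded_linear
              bounded_linear_scaleR_left) auto
        then obtain v where v: "(\<gamma> has_vector_derivative v) (at 0)"
          unfolding C1_on_def by (metis UNIV_I differentiableI vector_derivative_works)
        have "height (\<Phi> x) = 0"
          using x gap_\<Psi>[of "\<Phi> x"] by (simp add: inverse)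
        then have "v \<in> tangent_space {x. gap g x = 0} x"
          unfolding tangent_space_def
          using v y C1_on_subset[OF C1_\<gamma> subset_UNIV]
          by (intro CollectI exI[of _ \<gamma>] exI[of _ 1]) (auto simp: \<gamma>_def gap_\<Psi> inverse)
        \<comment> \<open>Only the base part of the velocity matters to \<open>DH x\<close>, and
          \<Psi> preserves it, so differentiating \<open>g\<close> along the curve is
          avoided.\<close>
        moreover have "base v = base y"
        proof (rule vector_derivative_unique_at)
          show "((\<lambda>s. base (\<gamma> s)) has_vector_derivative base v) (at 0)"
            by (rule bounded_linear.has_vector_derivative[OF bounded_linear_base v])
          show "((\<lambda>s. base (\<gamma> s)) has_vector_derivative base y) (at 0)"
            by (auto simp: \<gamma>_def base_\<Psi> intro!: derivative_eq_intros)
        qed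
        then have "DH x v = affine_eval \<alpha> y"
          using y by (metis DH0[OF x] point_base_height)
        ultimately show "affine_eval \<alpha> y \<in> DH x ` tangent_space {x. gap g x = 0} x"
          by (metis image_eqI)
      qed
    qed
    then show ?thesis
      by (simp add: dim_image_affine_eval[OF assms(2)] dim_height_0)
  qed
  have "admissible ?\<phi>"
    unfolding admissible_def using C2_family submanifold tangent by (auto simp: DH crit)
  then show ?thesis
    using fold graph crit by auto
qed

end
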